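(* Let $\Gamma$ be a finite two-player game with partial monitoring. There exists a finite subset $\{x_\ell;\ \ell\in\mathcal{L}\}$ of $\mathcal{X}$ that contains, for every $y\in\mathcal{Y}$, a maximizer of the program $\max_{x\in\mathcal{X}}\min_{U\in\Phi(y)}\langle x,U\rangle$, and such that the convex hull of $\{x_\ell;\ \ell\in\mathcal{L}\}$ contains, for every $y\in\mathcal{Y}$, the set of maximizers of this program. Moreover, for every $\ell\in\mathcal{L}$, the set $$Y_\ell=\Big\{y\in\mathcal{Y}:\ x_\ell\in\arg\max_{x\in\mathcal{X}}\min_{U\in\Phi(y)}\langle x,U\rangle\Big\}$$ on which $x_\ell$ is a maximizer is a finite union of polytopes. Similarly for player 2: there exists a finite subset $\{y_k;\ k\in\mathcal{K}\}$ of $\mathcal{Y}$ containing, for every $x\in\mathcal{X}$, a maximizer of $\max_{y\in\mathcal{Y}}\min_{V\in\Psi(x)}\langle y,V\rangle$, whose convex hull contains for every $x\in\mathcal{X}$ the set of maximizers, and such that for every $k\in\mathcal{K}$ the set $X_k$ of those $x\in\mathcal{X}$ for which $y_k$ is a maximizer is a finite union of polytopes.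
   Context: Game with partial monitoring: $\mathcal{A},\mathcal{B}$ are the finite action sets of players 1 and 2, of cardinalities $A$ and $B$; $\mathcal{X}=\Delta(\mathcal{A})$, $\mathcal{Y}=\Delta(\mathcal{B})$ are the sets of mixed actions (probability vectors); $u,v:\mathcal{A}\times\mathcal{B}\to\mathbb{R}$ are the payoffs of players 1 and 2, extended multilinearly to $\mathcal{X}\times\mathcal{Y}$. There are convex compact sets of messages $\mathcal{H},\mathcal{M}$ (in real vector spaces) and signaling maps $H:\mathcal{A}\times\mathcal{B}\to\mathcal{H}$, $M:\mathcal{A}\times\mathcal{B}\to\mathcal{M}$, also extended multilinearly. Put $\mathbf{H}(y)=[H(a,y)]_{a\in\mathcal{A}}\in\mathcal{H}^A$ for $y\in\mathcal{Y}$, $\mathbf{M}(x)=[M(x,b)]_{b\in\mathcal{B}}\in\mathcal{M}^B$ for $x\in\mathcal{X}$, and $$\Phi(y)=\{u(\cdot,y')\in\mathbb{R}^A:\ y'\in\mathcal{Y},\ \mathbf{H}(y')=\mathbf{H}(y)\},\qquad \Psi(x)=\{v(x',\cdot)\in\mathbb{R}^B:\ x'\in\mathcal{X},\ \mathbf{M}(x')=\mathbf{M}(x)\}.$$ A polytope is the convex hull of a finite number of points (an empty union of polytopes is allowed). *)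

theory Defs
  imports "HOL-Analysis.Analysis"
begin

definition mixed_actions :: "(real ^ 'n) set" where
  "mixed_actions = {x. (\<forall>i. 0 \<le> x $ i) \<and> (\<Sum>i\<in>UNIV. x $ i) = 1}"

definition multilin ::
    "('a \<Rightarrow> 'b \<Rightarrow> 'c::real_vector) \<Rightarrow> real ^ 'a \<Rightarrow> real ^ 'b \<Rightarrow> 'c" where
  "multilin f x y = (\<Sum>a\<in>UNIV. \<Sum>b\<in>UNIV. (x $ a * y $ b) *\<^sub>R f a b)"

(* A pure action a is identified with the Dirac mass axis a 1, so that f(a,y) is
   multilin f (axis a 1) y and f(x,b) is multilin f x (axis b 1). *)

definition row_vec :: "('a \<Rightarrow> 'b \<Rightarrow> 'c::real_vector) \<Rightarrow> real ^ 'b \<Rightarrow> 'c ^ 'a" where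
  "row_vec f y = (\<chi> a. multilin f (axis a 1) y)"

definition col_vec :: "('a \<Rightarrow> 'b \<Rightarrow> 'c::real_vector) \<Rightarrow> real ^ 'a \<Rightarrow> 'c ^ 'b" where
  "col_vec f x = (\<chi> b. multilin f x (axis b 1))"

definition Phi ::
    "('a \<Rightarrow> 'b \<Rightarrow> real) \<Rightarrow> ('a \<Rightarrow> 'b \<Rightarrow> 'h::real_vector) \<Rightarrow> real ^ 'b \<Rightarrow> (real ^ 'a) set" where
  "Phi u H y = {row_vec u y' | y'. y' \<in> mixed_actions \<and> row_vec H y' = row_vec H y}"

definition Psi ::
    "('a \<Rightarrow> 'b \<Rightarrow> real) \<Rightarrow> ('a \<Rightarrow> 'b \<Rightarrow> 'm::real_vector) \<Rightarrow> real ^ 'a \<Rightarrow> (real ^ 'b) set" where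
  "Psi v M x = {col_vec v x' | x'. x' \<in> mixed_actions \<and> col_vec M x' = col_vec M x}"

(* The minimum is written as an infimum; it is attained on Phi u H y and on Psi v M x for
   mixed actions y and x, see Phi_min_attained and Psi_min_attained. *)
definition worst_payoff :: "(real ^ 'n) set \<Rightarrow> real ^ 'n \<Rightarrow> real" where
  "worst_payoff S x = (INF U\<in>S. x \<bullet> U)"

definition maximizers :: "(real ^ 'n) set \<Rightarrow> (real ^ 'n) set" where
  "maximizers S = {x. is_arg_max (worst_payoff S) (\<lambda>x. x \<in> mixed_actions) x}"

lemma row_vec_nth: "row_vec f y $ a = (\<Sum>b\<in>UNIV. (y $ b) *\<^sub>R f a b)"
proof -
  have "(\<Sum>b\<in>UNIV. (axis a 1 $ a' * y $ b) *\<^sub>R f a' b)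
      = (if a' = a then \<Sum>b\<in>UNIV. (y $ b) *\<^sub>R f a b else 0)" for a'
    by (auto simp: axis_def)
  then show ?thesis by (simp add: row_vec_def multilin_def)
qed

lemma col_vec_eq_row_vec: "col_vec f = row_vec (\<lambda>b a. f a b)"
proof
  fix x
  have "col_vec f x $ b = row_vec (\<lambda>b a. f a b) x $ b" for b
  proof -
    have "(\<Sum>b'\<in>UNIV. (x $ a * axis b 1 $ b') *\<^sub>R f a b') = (x $ a) *\<^sub>R f a b" for a
    proof -
      have "(x $ a * axis b 1 $ b') *\<^sub>R f a b' = (if b' = b then (x $ a) *\<^sub>R f a b else 0)" for b'
        by (auto simp: axis_def)
      then show ?thesis by simp
    qed
    then show ?thesis by (simp add: row_vec_nth) (simp add: col_vec_def multilin_def)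
  qed
  then show "col_vec f x = row_vec (\<lambda>b a. f a b) x" by (simp add: vec_eq_iff)
qed

lemma Psi_eq_Phi: "Psi v M = Phi (\<lambda>b a. v a b) (\<lambda>b a. M a b)"
  by (simp add: Psi_def Phi_def col_vec_eq_row_vec fun_eq_iff)

lemma row_vec_add: "row_vec f (y + z) = row_vec f y + row_vec f z"
  by (simp add: vec_eq_iff row_vec_nth scaleR_left_distrib sum.distrib)

lemma row_vec_scaleR: "row_vec f (c *\<^sub>R y) $ a = c *\<^sub>R (row_vec f y $ a)"
  by (simp add: row_vec_nth scaleR_sum_right)

lemma row_vec_diff: "row_vec f (y - z) = row_vec f y - row_vec f z"
  by (simp add: vec_eq_iff row_vec_nth scaleR_left_diff_distrib sum_subtractf)

lemma subspace_row_vec_kernel: "subspace {z. row_vec f z = 0}"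
proof (rule subspaceI)
  show "0 \<in> {z. row_vec f z = 0}" by (simp add: vec_eq_iff row_vec_nth)
next
  fix x y assume "x \<in> {z. row_vec f z = 0}" "y \<in> {z. row_vec f z = 0}"
  then show "x + y \<in> {z. row_vec f z = 0}" by (simp add: row_vec_add)
next
  fix c x assume "x \<in> {z. row_vec f z = 0}"
  then show "c *\<^sub>R x \<in> {z. row_vec f z = 0}"
    by (simp add: vec_eq_iff row_vec_scaleR)
qed

lemma compact_mixed_actions: "compact (mixed_actions :: (real ^ 'n) set)"
proof -
  have cl: "closed (mixed_actions :: (real ^ 'n) set)"
  proof -
    have "(mixed_actions :: (real ^ 'n) set)
        = (\<Inter>i. {x :: real ^ 'n. 0 \<le> x $ i}) \<inter> {x. (\<Sum>i\<in>UNIV. x $ i) = 1}"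
      by (auto simp: mixed_actions_def)
    also have "closed \<dots>"
      by (intro closed_Int closed_INT closed_Collect_le closed_Collect_eq continuous_intros ballI)
    finally show ?thesis .
  qed
  have "norm x \<le> 1" if "x \<in> mixed_actions" for x :: "real ^ 'n"
    using norm_le_l1_cart[of x] that by (simp add: mixed_actions_def)
  then have "bounded (mixed_actions :: (real ^ 'n) set)"
    unfolding bounded_iff by blast
  with cl show ?thesis by (simp add: compact_eq_bounded_closed)
qed

lemma compact_Phi: "compact (Phi u H y)"
proof -
  let ?K = "{z. row_vec H z = 0}"
  have "closed ((\<lambda>z. y + z) ` ?K)"
    by (intro closed_translation closed_subspace subspace_row_vec_kernel)
  moreover have "(\<lambda>z. y + z) ` ?K = {y'. row_vec H y' = row_vec H y}"
  proof (intro set_eqI iffI)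
    fix y' assume "y' \<in> {y'. row_vec H y' = row_vec H y}"
    then have "y' - y \<in> ?K" by (simp add: row_vec_diff)
    then show "y' \<in> (\<lambda>z. y + z) ` ?K" by (rule rev_image_eqI) simp
  qed (auto simp: row_vec_add)
  ultimately have "compact (mixed_actions \<inter> {y'. row_vec H y' = row_vec H y})"
    by (metis compact_Int_closed compact_mixed_actions)
  moreover have "continuous_on S (row_vec u)" for S
    unfolding row_vec_def multilin_def by (intro continuous_intros)
  ultimately have "compact (row_vec u ` (mixed_actions \<inter> {y'. row_vec H y' = row_vec H y}))"
    by (rule compact_continuous_image[rotated])
  moreover have "row_vec u ` (mixed_actions \<inter> {y'. row_vec H y' = row_vec H y}) = Phi u H y"
    by (auto simp: Phi_def)
  ultimately show ?thesis by simp
qed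

lemma Phi_min_attained:
  assumes "y \<in> mixed_actions"
  shows "\<exists>U\<in>Phi u H y. worst_payoff (Phi u H y) x = x \<bullet> U \<and> (\<forall>U'\<in>Phi u H y. x \<bullet> U \<le> x \<bullet> U')"
proof -
  have "Phi u H y \<noteq> {}" using assms by (auto simp: Phi_def)
  moreover have "continuous_on (Phi u H y) (\<lambda>U. x \<bullet> U)" by (intro continuous_intros)
  ultimately obtain U where U: "U \<in> Phi u H y" "\<forall>U'\<in>Phi u H y. x \<bullet> U \<le> x \<bullet> U'"
    using continuous_attains_inf[OF compact_Phi] by blast
  then have "worst_payoff (Phi u H y) x = x \<bullet> U"
    unfolding worst_payoff_def by (intro cInf_eq_minimum) auto
  with U show ?thesis by blast
qed

lemma Psi_min_attained:
  assumes "x \<in> mixed_actions"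
  shows "\<exists>V\<in>Psi v M x. worst_payoff (Psi v M x) y = y \<bullet> V \<and> (\<forall>V'\<in>Psi v M x. y \<bullet> V \<le> y \<bullet> V')"
  unfolding Psi_eq_Phi by (rule Phi_min_attained[OF assms])

end

theory Submission
  imports Defs
begin

text \<open>
  By linear programming duality the worst payoff of \<open>x\<close> against \<open>y\<close> is the maximum of
  \<open>l \<bullet> y\<close> over the vectors \<open>l\<close> that are dominated by the payoff vector of \<open>x\<close> and annihilate all
  perturbations of \<open>y\<close> that player 1 cannot observe. The polyhedron of feasible pairs \<open>(x, l)\<close> does
  not depend on \<open>y\<close>, which enters the objective only. The optimal pairs for \<open>y\<close> therefore form a face
  of a fixed polyhedron. It has finitely many faces, so there are only finitely many sets of
  maximizers, each of which is a polytope, and the optimality of a given pair for \<open>y\<close> can be tested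
  against one representative of each face.
\<close>

section \<open>Faces on which a linear objective is maximal\<close>

definition maximizing_face :: "'e::euclidean_space set \<Rightarrow> 'e \<Rightarrow> 'e set" where
  "maximizing_face P c = {p \<in> P. \<forall>q\<in>P. c \<bullet> q \<le> c \<bullet> p}"

lemma maximizing_face_face_of:
  assumes "convex P"
  shows "maximizing_face P c face_of P"
proof (cases "maximizing_face P c = {}")
  case False
  then obtain p where p: "p \<in> P" "\<And>q. q \<in> P \<Longrightarrow> c \<bullet> q \<le> c \<bullet> p"
    by (auto simp: maximizing_face_def)
  then have "maximizing_face P c = P \<inter> {q. c \<bullet> q = c \<bullet> p}"
    by (force simp: maximizing_face_def)
  with p assms show ?thesis
    by (simp add: face_of_Int_supporting_hyperplane_le)
qed simp

text \<open>Infinitely many objectives share the finitely many faces of \<open>P\<close>. Every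
  finiteness claim about maximizers rests on this.\<close>

lemma finite_maximizing_faces:
  assumes "polyhedron P"
  shows "finite (range (maximizing_face P))"
proof (rule finite_subset)
  show "range (maximizing_face P) \<subseteq> {F. F face_of P}"
    using maximizing_face_face_of[OF polyhedron_imp_convex[OF assms]] by blast
qed (rule finite_polyhedron_faces[OF assms])

section \<open>Farkas' lemma relative to a subspace\<close>

text \<open>The claim is that \<open>f\<close> lies in the sum of the nonnegative orthant and
  \<open>W\<^sup>\<bottom>\<close>. This cone is finitely generated, hence closed; separating
  \<open>f\<close> from it would give a nonnegative vector of \<open>W\<close> on which
  \<open>f\<close> is negative.\<close>

lemma Farkas_subspace:
  fixes f :: "real ^ 'n"
  assumes W: "subspace W" and f: "\<And>w. w \<in> W \<Longrightarrow> (\<And>i. 0 \<le> w $ i) \<Longrightarrow> 0 \<le> f \<bullet> w"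
  obtains m where "\<And>i. 0 \<le> m $ i" "\<And>w. w \<in> W \<Longrightarrow> m \<bullet> w = f \<bullet> w"
proof -
  obtain B where B: "B \<subseteq> W\<^sup>\<bottom>" "independent B" "W\<^sup>\<bottom> \<subseteq> span B"
    by (rule basis_exists)
  then have "finite B" by (simp add: independent_imp_finite)
  \<comment> \<open>Generators of the orthant and, with both signs of a basis, of
    \<open>W\<^sup>\<bottom>\<close>. Finiteness of \<open>S\<close> makes its conic hull
    closed.\<close>
  define S where "S = range (\<lambda>i. axis i (1::real) :: real ^ 'n) \<union> B \<union> uminus ` B"
  define T where "T = {x :: real ^ 'n. \<exists>m. (\<forall>i. 0 \<le> m $ i) \<and> (\<forall>w\<in>W. m \<bullet> w = x \<bullet> w)}"
  have "f \<in> convex_cone hull S"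
  proof (rule ccontr)
    assume "f \<notin> convex_cone hull S"
    moreover have "finite S" using \<open>finite B\<close> by (simp add: S_def)
    ultimately obtain a r where ar: "a \<bullet> f < r" "\<And>x. x \<in> convex_cone hull S \<Longrightarrow> r < a \<bullet> x"
      using separating_hyperplane_closed_point[OF convex_convex_cone_hull closed_convex_cone_hull, of S f]
      by blast
    have "r < 0" using ar(2)[OF convex_cone_hull_contains_0] by simp
    have pos: "0 \<le> a \<bullet> x" if "x \<in> S" for x
    proof (rule ccontr)
      assume *: "\<not> 0 \<le> a \<bullet> x"
      \<comment> \<open>This positive multiple of \<open>x\<close> has inner product exactly
        \<open>r\<close> with \<open>a\<close>, against the strict bound on the cone.\<close>
      have "(r / (a \<bullet> x)) *\<^sub>R x \<in> convex_cone hull S"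
        using * \<open>r < 0\<close> that by (intro convex_cone_hull_mul hull_inc divide_nonpos_nonpos) auto
      from ar(2)[OF this] * show False by simp
    qed
    have "0 \<le> a $ i" for i
      using pos[of "axis i 1"] by (simp add: S_def inner_axis)
    \<comment> \<open>Both signs of each basis vector lie in \<open>S\<close>, so \<open>a\<close>
      is orthogonal to \<open>W\<^sup>\<bottom>\<close>, and the double complement of
      \<open>W\<close> is \<open>W\<close>.\<close>
    moreover have "a \<in> W"
    proof -
      have "a \<bullet> x = 0" if "x \<in> B" for x
        using pos[of x] pos[of "- x"] that by (auto simp: S_def)
      then have "B \<subseteq> {x. a \<bullet> x = 0}" by auto
      then have "W\<^sup>\<bottom> \<subseteq> {x. a \<bullet> x = 0}"
        using span_minimal[OF _ subspace_hyperplane] B(3) by blast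
      then have "a \<in> W\<^sup>\<bottom>\<^sup>\<bottom>" by (auto simp: orthogonal_comp_def orthogonal_def inner_commute)
      then show ?thesis by (simp add: orthogonal_comp_self W)
    qed
    ultimately have "0 \<le> f \<bullet> a" using f by blast
    with ar(1) \<open>r < 0\<close> show False by (simp add: inner_commute)
  qed
  moreover have "convex_cone hull S \<subseteq> T"
  proof (rule hull_minimal)
    have "axis i 1 \<in> T" for i
      unfolding T_def by (auto simp: axis_def intro!: exI[of _ "axis i 1"])
    moreover have "x \<in> T" "- x \<in> T" if "x \<in> B" for x
    proof -
      have "x \<in> W\<^sup>\<bottom>" using that B(1) by blast
      then have "\<forall>w\<in>W. 0 = x \<bullet> w" by (auto simp: orthogonal_comp_def orthogonal_def inner_commute)
      then show "x \<in> T" "- x \<in> T" unfolding T_def by (auto intro!: exI[of _ 0])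
    qed
    ultimately show "S \<subseteq> T" by (auto simp: S_def)
  next
    have "x + y \<in> T" if "x \<in> T" "y \<in> T" for x y
    proof -
      from that obtain m n where "\<forall>i. 0 \<le> m $ i" "\<forall>w\<in>W. m \<bullet> w = x \<bullet> w"
        "\<forall>i. 0 \<le> n $ i" "\<forall>w\<in>W. n \<bullet> w = y \<bullet> w" by (auto simp: T_def)
      then show ?thesis
        unfolding T_def by (auto simp: inner_add_left intro!: exI[of _ "m + n"])
    qed
    moreover have "t *\<^sub>R x \<in> T" if "x \<in> T" "0 \<le> t" for x t
    proof -
      from that obtain m where "\<forall>i. 0 \<le> m $ i" "\<forall>w\<in>W. m \<bullet> w = x \<bullet> w" by (auto simp: T_def)
      with that(2) show ?thesis
        unfolding T_def by (auto intro!: exI[of _ "t *\<^sub>R m"])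
    qed
    moreover have "0 \<in> T" unfolding T_def by (auto intro!: exI[of _ 0])
    ultimately show "convex_cone T" unfolding convex_cone_iff by blast
  qed
  ultimately have "f \<in> T" by blast
  then show thesis using that by (auto simp: T_def)
qed

section \<open>Polyhedral structure of mixed actions, payoff sets and maximizers\<close>

lemma polyhedron_INT:
  fixes S :: "'i::finite \<Rightarrow> 'e::euclidean_space set"
  assumes "\<And>i. polyhedron (S i)"
  shows "polyhedron (\<Inter>i. S i)"
  using assms by (intro polyhedron_Inter) auto

lemma polyhedron_Ball_halfspace:
  fixes A :: "'e::euclidean_space set"
  assumes "finite A"
  shows "polyhedron {x. \<forall>a\<in>A. a \<bullet> x \<le> b a}"
proof -
  have "{x. \<forall>a\<in>A. a \<bullet> x \<le> b a} = \<Inter>((\<lambda>a. {x. a \<bullet> x \<le> b a}) ` A)" by auto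
  with assms show ?thesis by (auto simp: polyhedron_halfspace_le)
qed

lemma inner_vec_one: "(\<chi> i. 1) \<bullet> x = (\<Sum>i\<in>UNIV. x $ i)" for x :: "real ^ 'n"
  by (simp add: inner_vec_def)

lemma polyhedron_mixed_actions: "polyhedron (mixed_actions :: (real ^ 'n) set)"
proof -
  have "mixed_actions = (\<Inter>i. {x :: real ^ 'n. axis i 1 \<bullet> x \<ge> 0}) \<inter> {x. (\<chi> i. 1) \<bullet> x = 1}"
    by (auto simp: mixed_actions_def inner_axis' inner_vec_one)
  also have "polyhedron \<dots>"
    by (intro polyhedron_Int polyhedron_INT polyhedron_halfspace_ge polyhedron_hyperplane)
  finally show ?thesis .
qed

lemma polytope_mixed_actions: "polytope (mixed_actions :: (real ^ 'n) set)"
  by (simp add: polytope_eq_bounded_polyhedron polyhedron_mixed_actions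
      compact_imp_bounded compact_mixed_actions)

lemma mixed_actions_nonempty: "mixed_actions \<noteq> ({} :: (real ^ 'n) set)"
proof -
  have "axis undefined 1 \<in> (mixed_actions :: (real ^ 'n) set)"
    by (auto simp: mixed_actions_def axis_def)
  then show ?thesis by blast
qed

lemma linear_row_vec: "linear (row_vec f)"
  by (rule linearI) (auto simp: row_vec_add vec_eq_iff row_vec_scaleR)

text \<open>The mixed actions indistinguishable from \<open>y\<close> form an affine slice of the
  simplex, and \<open>row_vec u\<close> maps this polytope linearly onto
  \<open>Phi u H y\<close>.\<close>

lemma polytope_Phi:
  assumes "y \<in> mixed_actions"
  shows "polytope (Phi u H y)"
proof -
  have "affine {y'. row_vec H y' = row_vec H y}"
    unfolding affine_def by (auto simp: row_vec_add vec_eq_iff row_vec_scaleR simp flip: scaleR_left_distrib)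
  then have "polytope (mixed_actions \<inter> {y'. row_vec H y' = row_vec H y})"
    by (intro polytope_Int_polyhedron polytope_mixed_actions affine_imp_polyhedron)
  then have "polytope (row_vec u ` (mixed_actions \<inter> {y'. row_vec H y' = row_vec H y}))"
    by (intro polytope_linear_image linear_row_vec)
  also have "row_vec u ` (mixed_actions \<inter> {y'. row_vec H y' = row_vec H y}) = Phi u H y"
    by (auto simp: Phi_def)
  finally show ?thesis .
qed

lemma worst_payoff_le:
  assumes "y \<in> mixed_actions" "U \<in> Phi u H y"
  shows "worst_payoff (Phi u H y) x \<le> x \<bullet> U"
  using Phi_min_attained[OF assms(1), of u H x] assms(2) by metis

text \<open>A minimum of functions linear in \<open>x\<close> is concave. Stated on the whole space,
  this yields continuity and hence the existence of maximizers.\<close>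

lemma concave_worst_payoff:
  fixes u :: "'a::finite \<Rightarrow> 'b::finite \<Rightarrow> real"
  assumes "y \<in> mixed_actions"
  shows "concave_on UNIV (worst_payoff (Phi u H y))"
  unfolding concave_on_iff
proof (intro conjI allI ballI impI)
  fix x x' :: "real ^ 'a" and s t :: real
  assume st: "0 \<le> s" "0 \<le> t" "s + t = 1"
  obtain U where U: "U \<in> Phi u H y"
    "worst_payoff (Phi u H y) (s *\<^sub>R x + t *\<^sub>R x') = (s *\<^sub>R x + t *\<^sub>R x') \<bullet> U"
    using Phi_min_attained[OF assms] by metis
  show "s * worst_payoff (Phi u H y) x + t * worst_payoff (Phi u H y) x'
      \<le> worst_payoff (Phi u H y) (s *\<^sub>R x + t *\<^sub>R x')"
    unfolding U(2) using st U(1) assms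
    by (auto simp: inner_add_left intro!: add_mono mult_left_mono worst_payoff_le)
qed simp

lemma mem_maximizers_iff:
  "x \<in> maximizers S \<longleftrightarrow>
    x \<in> mixed_actions \<and> (\<forall>x'\<in>mixed_actions. worst_payoff S x' \<le> worst_payoff S x)"
  by (auto simp: maximizers_def is_arg_max_def not_less)

lemma maximizers_nonempty:
  assumes "y \<in> mixed_actions"
  shows "maximizers (Phi u H y) \<noteq> {}"
proof -
  have "continuous_on UNIV (\<lambda>x. - worst_payoff (Phi u H y) x)"
    using concave_worst_payoff[OF assms] by (intro convex_on_continuous) (auto simp: concave_on_def)
  then have "continuous_on mixed_actions (\<lambda>x. - worst_payoff (Phi u H y) x)"
    by (rule continuous_on_subset) simp
  from continuous_attains_inf[OF compact_mixed_actions mixed_actions_nonempty this]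
  obtain x where "x \<in> maximizers (Phi u H y)" by (auto simp: mem_maximizers_iff)
  then show ?thesis by blast
qed

text \<open>Maximizers are the mixed actions whose worst payoff reaches the optimal value. Since
  \<open>Phi u H y\<close> is the hull of a finite set \<open>V\<close>, this amounts to finitely
  many linear inequalities, one for each point of \<open>V\<close>.\<close>

lemma polytope_maximizers:
  assumes "y \<in> mixed_actions"
  shows "polytope (maximizers (Phi u H y))"
proof -
  obtain V where V: "finite V" "Phi u H y = convex hull V"
    using polytope_Phi[OF assms, of u H] unfolding polytope_def by blast
  obtain m where m: "m \<in> maximizers (Phi u H y)" using maximizers_nonempty[OF assms] by blast
  let ?v = "worst_payoff (Phi u H y) m"
  have ge: "?v \<le> worst_payoff (Phi u H y) x \<longleftrightarrow> (\<forall>U\<in>V. ?v \<le> x \<bullet> U)" for x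
  proof
    assume "?v \<le> worst_payoff (Phi u H y) x"
    then show "\<forall>U\<in>V. ?v \<le> x \<bullet> U"
      using worst_payoff_le[OF assms, of _ u H x] unfolding V(2) by (meson hull_inc order_trans)
  next
    assume "\<forall>U\<in>V. ?v \<le> x \<bullet> U"
    then have "convex hull V \<subseteq> {U. x \<bullet> U \<ge> ?v}"
      by (intro hull_minimal convex_halfspace_ge) auto
    moreover obtain U where "U \<in> Phi u H y" "worst_payoff (Phi u H y) x = x \<bullet> U"
      using Phi_min_attained[OF assms] by metis
    ultimately show "?v \<le> worst_payoff (Phi u H y) x" using V(2) by auto
  qed
  have eq: "maximizers (Phi u H y) = mixed_actions \<inter> {x. \<forall>a\<in>uminus ` V. a \<bullet> x \<le> - ?v}"
  proof -
    have "x \<in> maximizers (Phi u H y) \<longleftrightarrow> x \<in> mixed_actions \<and> ?v \<le> worst_payoff (Phi u H y) x" for x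
      using m by (auto simp: mem_maximizers_iff intro: order_trans)
    then show ?thesis by (auto simp: ge inner_commute)
  qed
  show ?thesis
    unfolding eq using V(1)
    by (intro polytope_Int_polyhedron polytope_mixed_actions polyhedron_Ball_halfspace finite_imageI)
qed

section \<open>Linear programming duality for the worst payoff\<close>

text \<open>Differences of indistinguishable mixed actions lie here. The zero-sum condition puts the
  constant vectors into the orthogonal complement, where they serve as multipliers for the total
  mass constraint. The messages enter the dual program only through this subspace of a Euclidean
  space.\<close>

definition unobservable :: "('a::finite \<Rightarrow> 'b::finite \<Rightarrow> 'h::real_vector) \<Rightarrow> (real ^ 'b) set" where
  "unobservable H = {w. row_vec H w = 0 \<and> (\<Sum>b\<in>UNIV. w $ b) = 0}"

definition dual_pairs ::
    "('a::finite \<Rightarrow> 'b::finite \<Rightarrow> real) \<Rightarrow> ('a \<Rightarrow> 'b \<Rightarrow> 'h::real_vector) \<Rightarrow> ((real ^ 'a) \<times> (real ^ 'b)) set" where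
  "dual_pairs u H = {(x, l). x \<in> mixed_actions \<and> l \<in> (unobservable H)\<^sup>\<bottom> \<and> (\<forall>b. l $ b \<le> col_vec u x $ b)}"

lemma col_vec_nth: "col_vec u x $ b = (\<Sum>a\<in>UNIV. (x $ a) *\<^sub>R u a b)"
  by (simp add: col_vec_eq_row_vec row_vec_nth)

lemma inner_row_vec: "x \<bullet> row_vec u y = col_vec u x \<bullet> y"
proof -
  have "x \<bullet> row_vec u y = (\<Sum>a\<in>UNIV. \<Sum>b\<in>UNIV. x $ a * (y $ b * u a b))"
    by (simp add: inner_vec_def row_vec_nth sum_distrib_left)
  also have "\<dots> = (\<Sum>b\<in>UNIV. \<Sum>a\<in>UNIV. x $ a * (y $ b * u a b))" by (rule sum.swap)
  also have "\<dots> = col_vec u x \<bullet> y"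
    by (simp add: inner_vec_def col_vec_nth sum_distrib_left sum_distrib_right mult_ac)
  finally show ?thesis .
qed

lemma subspace_unobservable: "subspace (unobservable H)"
proof -
  have "unobservable H = {z. row_vec H z = 0} \<inter> {z. (\<chi> b. 1) \<bullet> z = 0}"
    by (auto simp: unobservable_def inner_vec_one)
  then show ?thesis
    by (simp add: subspace_row_vec_kernel subspace_hyperplane subspace_inter)
qed

lemma polyhedron_dual_pairs:
  fixes u :: "'a::finite \<Rightarrow> 'b::finite \<Rightarrow> real"
  shows "polyhedron (dual_pairs u H)"
proof -
  have "polyhedron (snd -` ((unobservable H)\<^sup>\<bottom>) :: ((real ^ 'a) \<times> (real ^ 'b)) set)"
    by (intro affine_imp_polyhedron subspace_imp_affine linear_subspace_vimage subspace_orthogonal_comp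
        linear_snd)
  moreover have "polyhedron (\<Inter>i. {p :: (real ^ 'a) \<times> (real ^ 'b). (axis i 1, 0) \<bullet> p \<ge> 0})"
    by (intro polyhedron_INT polyhedron_halfspace_ge)
  moreover have "polyhedron {p :: (real ^ 'a) \<times> (real ^ 'b). ((\<chi> i. 1), 0) \<bullet> p = 1}"
    by (rule polyhedron_hyperplane)
  \<comment> \<open>In the product space, \<open>l $ b \<le> col_vec u x $ b\<close> becomes one
    halfspace, with the payoffs moved to the left side.\<close>
  moreover have "polyhedron (\<Inter>b. {p :: (real ^ 'a) \<times> (real ^ 'b). ((\<chi> a. - u a b), axis b 1) \<bullet> p \<le> 0})"
    by (intro polyhedron_INT polyhedron_halfspace_le)
  moreover have inner_payoff: "(\<chi> a. - u a b) \<bullet> x = - (\<Sum>a\<in>UNIV. u a b * x $ a)" for b x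
    by (simp add: inner_vec_def sum_negf)
  then have "dual_pairs u H = snd -` ((unobservable H)\<^sup>\<bottom>)
      \<inter> (\<Inter>i. {p. (axis i 1, 0) \<bullet> p \<ge> 0}) \<inter> {p. ((\<chi> i. 1), 0) \<bullet> p = 1}
      \<inter> (\<Inter>b. {p. ((\<chi> a. - u a b), axis b 1) \<bullet> p \<le> 0})"
    by (auto simp: dual_pairs_def mixed_actions_def inner_axis' inner_vec_one inner_payoff
        col_vec_nth mult.commute)
  ultimately show ?thesis by (simp only: polyhedron_Int)
qed

text \<open>For a minimizing \<open>y'\<close>, \<open>l\<close> takes the same value at
  \<open>y\<close> and \<open>y'\<close>, since their difference is unobservable. Nonnegativity of
  \<open>y'\<close> then turns the domination of \<open>l\<close> into the bound.\<close>

lemma weak_duality: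
  assumes y: "y \<in> mixed_actions" and p: "(x, l) \<in> dual_pairs u H"
  shows "l \<bullet> y \<le> worst_payoff (Phi u H y) x"
proof -
  obtain y' where y': "y' \<in> mixed_actions" "row_vec H y' = row_vec H y"
    "worst_payoff (Phi u H y) x = x \<bullet> row_vec u y'"
    using Phi_min_attained[OF y, of u H x] by (auto simp: Phi_def)
  have "y - y' \<in> unobservable H"
    using y y' by (simp add: unobservable_def row_vec_diff mixed_actions_def sum_subtractf)
  then have "l \<bullet> (y - y') = 0"
    using p by (auto simp: dual_pairs_def orthogonal_comp_def orthogonal_def inner_commute)
  then have "l \<bullet> y = l \<bullet> y'" by (simp add: inner_diff_right)
  also have "\<dots> \<le> col_vec u x \<bullet> y'"
    using p y'(1) unfolding inner_vec_def
    by (auto simp: dual_pairs_def mixed_actions_def intro!: sum_mono mult_right_mono)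
  finally show ?thesis by (simp add: y'(3) inner_row_vec)
qed

text \<open>Farkas' lemma is applied to the payoff vector of \<open>x\<close> minus its worst payoff
  in every coordinate; the nonnegative vector it returns is the slack between the payoff vector and
  \<open>l\<close>.\<close>

lemma strong_duality:
  fixes u :: "'a::finite \<Rightarrow> 'b::finite \<Rightarrow> real"
  assumes y: "y \<in> mixed_actions" and x: "x \<in> mixed_actions"
  obtains l where "(x, l) \<in> dual_pairs u H" "l \<bullet> y = worst_payoff (Phi u H y) x"
proof -
  let ?v = "worst_payoff (Phi u H y) x"
  let ?one = "(\<chi> b. 1) :: real ^ 'b"
  \<comment> \<open>A nonnegative vector of \<open>?W\<close> is either 0 or a multiple of a mixed action indistinguishable
    from \<open>y\<close>, which makes Farkas' lemma applicable to \<open>?W\<close>.\<close>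
  let ?W = "{w + t *\<^sub>R y | w t. w \<in> unobservable H}"
  have one_y: "?one \<bullet> y = 1" and y_nonneg: "\<And>b. 0 \<le> y $ b"
    using y by (auto simp: mixed_actions_def inner_vec_one)
  have one_w: "?one \<bullet> w = 0" if "w \<in> unobservable H" for w
    using that by (auto simp: unobservable_def inner_vec_one)
  have W: "subspace ?W"
  proof (rule subspaceI)
    show "0 \<in> ?W" using subspace_0[OF subspace_unobservable] by (auto intro!: exI[of _ 0])
  next
    fix a b assume "a \<in> ?W" "b \<in> ?W"
    then obtain w t w' t' where "a = w + t *\<^sub>R y" "b = w' + t' *\<^sub>R y"
      "w \<in> unobservable H" "w' \<in> unobservable H" by blast
    then show "a + b \<in> ?W"
      using subspace_add[OF subspace_unobservable]
      by (auto simp: algebra_simps intro!: exI[of _ "w + w'"] exI[of _ "t + t'"])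
  next
    fix c a assume "a \<in> ?W"
    then obtain w t where "a = w + t *\<^sub>R y" "w \<in> unobservable H" by blast
    then show "c *\<^sub>R a \<in> ?W"
      using subspace_scale[OF subspace_unobservable]
      by (auto simp: algebra_simps intro!: exI[of _ "c *\<^sub>R w"] exI[of _ "c * t"])
  qed
  have nonneg: "0 \<le> (col_vec u x - ?v *\<^sub>R ?one) \<bullet> z" if "z \<in> ?W" "\<And>b. 0 \<le> z $ b" for z
  proof -
    from that(1) obtain w t where z: "z = w + t *\<^sub>R y" and w: "w \<in> unobservable H" by blast
    \<comment> \<open>Unobservable vectors have total mass 0 and \<open>y\<close> has total mass 1,
      so \<open>t\<close> is the mass by which \<open>z\<close> must be normalized.\<close>
    have t: "t = (\<Sum>b\<in>UNIV. z $ b)"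
      using one_w[OF w] one_y unfolding inner_vec_one[symmetric] z by (simp add: inner_add_right)
    show ?thesis
    proof (cases "t = 0")
      case True
      then have "z = 0" using t that(2) by (simp add: sum_nonneg_eq_0_iff vec_eq_iff)
      then show ?thesis by simp
    next
      case False
      then have "t > 0" using t that(2) by (simp add: sum_nonneg order_less_le)
      let ?y' = "inverse t *\<^sub>R z"
      have "?y' \<in> mixed_actions"
        using that(2) \<open>t > 0\<close> t by (simp add: mixed_actions_def flip: sum_distrib_left)
      moreover have "row_vec H ?y' = row_vec H y"
        using w \<open>t > 0\<close> by (simp add: z linear_add[OF linear_row_vec] linear_cmul[OF linear_row_vec]
            unobservable_def)
      ultimately have "?v \<le> x \<bullet> row_vec u ?y'"
        by (intro worst_payoff_le y) (auto simp: Phi_def)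
      then have "t * ?v \<le> col_vec u x \<bullet> z"
        using \<open>t > 0\<close> by (simp add: inner_row_vec field_simps)
      moreover have "?one \<bullet> z = t" by (simp add: t inner_vec_one)
      ultimately show ?thesis by (simp add: inner_diff_left mult.commute)
    qed
  qed
  obtain m where m: "\<And>b. 0 \<le> m $ b"
    "\<And>z. z \<in> ?W \<Longrightarrow> m \<bullet> z = (col_vec u x - ?v *\<^sub>R ?one) \<bullet> z"
    using Farkas_subspace[OF W nonneg] by blast
  \<comment> \<open>Nonnegativity of \<open>m\<close> gives domination. On \<open>?W\<close>,
    \<open>l\<close> acts as \<open>?v\<close> times the total mass, hence vanishes on unobservable
    vectors and equals \<open>?v\<close> at \<open>y\<close>.\<close>
  define l where "l = col_vec u x - m"
  have l: "l \<bullet> z = ?v * (?one \<bullet> z)" if "z \<in> ?W" for z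
    using m(2)[OF that] by (simp add: l_def inner_diff_left)
  have "l \<bullet> w = 0" if "w \<in> unobservable H" for w
  proof -
    have "w \<in> ?W" using that by (intro CollectI exI[of _ w] exI[of _ 0]) simp
    then show ?thesis using l one_w[OF that] by simp
  qed
  then have "(x, l) \<in> dual_pairs u H"
    using x m(1) by (auto simp: dual_pairs_def l_def orthogonal_comp_def orthogonal_def inner_commute)
  moreover have "y \<in> ?W"
    using subspace_0[OF subspace_unobservable] by (intro CollectI exI[of _ 0] exI[of _ 1]) simp
  then have "l \<bullet> y = ?v" using l one_y by simp
  ultimately show thesis by (rule that)
qed

text \<open>For fixed \<open>x\<close>, duality makes the worst payoff the maximum of
  \<open>l \<bullet> y\<close> over feasible \<open>l\<close>. Maximizing jointly over pairs and
  projecting to \<open>x\<close> therefore solves the max-min program.\<close>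

lemma maximizers_eq_fst_face:
  assumes y: "y \<in> mixed_actions"
  shows "maximizers (Phi u H y) = fst ` maximizing_face (dual_pairs u H) (0, y)"
proof (intro set_eqI iffI)
  fix x assume x: "x \<in> maximizers (Phi u H y)"
  then have xm: "x \<in> mixed_actions" by (simp add: mem_maximizers_iff)
  obtain l where l: "(x, l) \<in> dual_pairs u H" "l \<bullet> y = worst_payoff (Phi u H y) x"
    using strong_duality[OF y xm] by blast
  have "l' \<bullet> y \<le> l \<bullet> y" if "(x', l') \<in> dual_pairs u H" for x' l'
  proof -
    have "x' \<in> mixed_actions" using that by (simp add: dual_pairs_def)
    then show ?thesis
      using weak_duality[OF y that] x l(2) by (auto simp: mem_maximizers_iff intro: order_trans)
  qed
  with l(1) have "(x, l) \<in> maximizing_face (dual_pairs u H) (0, y)"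
    by (auto simp: maximizing_face_def inner_commute)
  then show "x \<in> fst ` maximizing_face (dual_pairs u H) (0, y)" by force
next
  fix x assume "x \<in> fst ` maximizing_face (dual_pairs u H) (0, y)"
  then obtain l where l: "(x, l) \<in> dual_pairs u H"
    "\<And>x' l'. (x', l') \<in> dual_pairs u H \<Longrightarrow> l' \<bullet> y \<le> l \<bullet> y"
    by (force simp: maximizing_face_def inner_commute)
  \<comment> \<open>Strong duality gives \<open>x'\<close> a partner attaining its worst payoff,
    optimality of \<open>l\<close> bounds that value by \<open>l \<bullet> y\<close>, and weak
    duality compares the latter with \<open>x\<close>.\<close>
  have "worst_payoff (Phi u H y) x' \<le> worst_payoff (Phi u H y) x" if "x' \<in> mixed_actions" for x'
    using strong_duality[OF y that, of u H] l(2) weak_duality[OF y l(1)] by (metis order_trans)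
  with l(1) show "x \<in> maximizers (Phi u H y)" by (auto simp: mem_maximizers_iff dual_pairs_def)
qed

section \<open>Finiteness of the optimal set and structure of the optimality regions\<close>

text \<open>The multiplier certifying optimality of \<open>x\<close> may vary with \<open>y\<close>,
  but one choice per face containing some \<open>(x, l)\<close> suffices. For a fixed multiplier,
  optimality at \<open>y\<close> is a finite system of linear inequalities in \<open>y\<close>; the
  union runs over these faces.\<close>

lemma finite_union_of_polytope_maximizer_region:
  fixes u :: "'a::finite \<Rightarrow> 'b::finite \<Rightarrow> real"
  shows "(finite union_of polytope) {y \<in> mixed_actions. x \<in> maximizers (Phi u H y)}"
proof -
  define P where "P = dual_pairs u H"
  \<comment> \<open>An objective without maximizer gives the empty face, which has no representative
    and is removed.\<close>
  define \<F> where "\<F> = range (maximizing_face P) - {{}}"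
  define rep where "rep F = (SOME p. p \<in> F)" for F :: "((real ^ 'a) \<times> (real ^ 'b)) set"
  have fin: "finite \<F>"
    unfolding \<F>_def P_def using finite_maximizing_faces[OF polyhedron_dual_pairs] by blast
  have rep: "rep F \<in> F" if "F \<in> \<F>" for F
    using that unfolding rep_def \<F>_def by (simp add: some_in_eq)
  have rep_P: "rep F \<in> P" if "F \<in> \<F>" for F
    using rep[OF that] that by (auto simp: \<F>_def maximizing_face_def)
  define \<G> where "\<G> = {F \<in> \<F>. x \<in> fst ` F}"
  define lam where "lam F = (SOME l. (x, l) \<in> F)" for F :: "((real ^ 'a) \<times> (real ^ 'b)) set"
  have lam: "(x, lam F) \<in> F" if "F \<in> \<G>" for F
    using that unfolding lam_def \<G>_def by (force intro: someI)
  have lam_P: "(x, lam F) \<in> P" if "F \<in> \<G>" for F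
    using lam[OF that] that by (auto simp: \<G>_def \<F>_def maximizing_face_def)
  \<comment> \<open>\<open>Y F\<close> collects the \<open>y\<close> at which the pair
    \<open>(x, lam F)\<close> does at least as well as every representative.\<close>
  define Y where "Y F = mixed_actions \<inter> {y. \<forall>a\<in>(\<lambda>F'. snd (rep F') - lam F) ` \<F>. a \<bullet> y \<le> 0}"
    for F
  have "{y \<in> mixed_actions. x \<in> maximizers (Phi u H y)} = \<Union>(Y ` \<G>)"
  proof (intro set_eqI iffI)
    fix y assume "y \<in> {y \<in> mixed_actions. x \<in> maximizers (Phi u H y)}"
    then have y: "y \<in> mixed_actions" and x: "x \<in> fst ` maximizing_face P (0, y)"
      by (auto simp: maximizers_eq_fst_face P_def)
    let ?F = "maximizing_face P (0, y)"
    have F: "?F \<in> \<G>" using x by (auto simp: \<G>_def \<F>_def)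
    have "(0, y) \<bullet> q \<le> (0, y) \<bullet> (x, lam ?F)" if "q \<in> P" for q
      using lam[OF F] that unfolding maximizing_face_def by blast
    from this[OF rep_P] have "snd (rep F') \<bullet> y \<le> lam ?F \<bullet> y" if "F' \<in> \<F>" for F'
      using that by (simp add: inner_prod_def inner_commute)
    then have "y \<in> Y ?F" using y by (auto simp: Y_def inner_diff_left)
    with F show "y \<in> \<Union>(Y ` \<G>)" by blast
  next
    fix y assume "y \<in> \<Union>(Y ` \<G>)"
    then obtain F where F: "F \<in> \<G>" and yF: "y \<in> Y F" by blast
    then have y: "y \<in> mixed_actions" by (simp add: Y_def)
    let ?F = "maximizing_face P (0, y)"
    \<comment> \<open>Maximizers exist at \<open>y\<close>, so the optimal face is nonempty and its
      representative is among those tested. Doing as well as this representative means being optimal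
      over \<open>P\<close>.\<close>
    have "?F \<noteq> {}"
      using maximizers_nonempty[OF y, of u H] by (auto simp: maximizers_eq_fst_face[OF y] P_def)
    then have F': "?F \<in> \<F>" by (simp add: \<F>_def)
    then have "snd (rep ?F) \<bullet> y \<le> lam F \<bullet> y"
      using yF by (auto simp: Y_def inner_diff_left)
    then have "(0, y) \<bullet> rep ?F \<le> (0, y) \<bullet> (x, lam F)"
      by (cases "rep ?F") (simp add: inner_commute)
    moreover have "(0, y) \<bullet> q \<le> (0, y) \<bullet> rep ?F" if "q \<in> P" for q
      using rep[OF F'] that unfolding maximizing_face_def by blast
    ultimately have "(x, lam F) \<in> ?F"
      using lam_P[OF F] unfolding maximizing_face_def by (auto intro: order_trans)
    then show "y \<in> {y \<in> mixed_actions. x \<in> maximizers (Phi u H y)}"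
      using y by (force simp: maximizers_eq_fst_face P_def)
  qed
  moreover have "polytope (Y F)" for F
    unfolding Y_def using fin
    by (intro polytope_Int_polyhedron polytope_mixed_actions polyhedron_Ball_halfspace finite_imageI)
  moreover have "finite \<G>" using fin by (simp add: \<G>_def)
  ultimately show ?thesis
    unfolding union_of_def by (intro exI[of _ "Y ` \<G>"]) auto
qed

text \<open>Only finitely many sets of maximizers occur, each a polytope. Collecting finite
  generating sets of all of them gives \<open>L\<close>: each nonempty set of maximizers contributes
  one of its points and lies in the hull.\<close>

lemma finite_optimal_set:
  fixes u :: "'a::finite \<Rightarrow> 'b::finite \<Rightarrow> real" and H :: "'a \<Rightarrow> 'b \<Rightarrow> 'h::real_vector"
  shows "\<exists>L. finite L \<and> L \<subseteq> mixed_actions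
            \<and> (\<forall>y\<in>mixed_actions. \<exists>x\<in>L. x \<in> maximizers (Phi u H y))
            \<and> (\<forall>y\<in>mixed_actions. maximizers (Phi u H y) \<subseteq> convex hull L)
            \<and> (\<forall>x\<in>L. (finite union_of polytope)
                  {y \<in> mixed_actions. x \<in> maximizers (Phi u H y)})"
proof -
  define \<E> where "\<E> = (\<lambda>y. maximizers (Phi u H y)) ` mixed_actions"
  have "\<E> \<subseteq> image fst ` range (maximizing_face (dual_pairs u H))"
  proof
    fix E assume "E \<in> \<E>"
    then obtain y where y: "y \<in> mixed_actions" and E: "E = maximizers (Phi u H y)"
      unfolding \<E>_def by (rule imageE)
    show "E \<in> image fst ` range (maximizing_face (dual_pairs u H))"
      unfolding E maximizers_eq_fst_face[OF y] by (intro imageI rangeI)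
  qed
  then have fin: "finite \<E>"
    by (rule finite_subset) (intro finite_imageI finite_maximizing_faces polyhedron_dual_pairs)
  define V where "V E = (SOME V. finite V \<and> E = convex hull V)" for E :: "(real ^ 'a) set"
  have V: "finite (V E) \<and> E = convex hull V E" if "E \<in> \<E>" for E
  proof -
    have "polytope E" using that by (auto simp: \<E>_def polytope_maximizers)
    then show ?thesis unfolding polytope_def V_def by (rule someI_ex)
  qed
  define L where "L = (\<Union>E\<in>\<E>. V E)"
  have "finite L" unfolding L_def using fin V by blast
  have VE: "V E \<subseteq> E" if "E \<in> \<E>" for E
    by (subst (2) conjunct2[OF V[OF that]]) (rule hull_subset)
  have "E \<subseteq> mixed_actions" if "E \<in> \<E>" for E
    using that by (auto simp: \<E>_def mem_maximizers_iff)
  with VE have "V E \<subseteq> mixed_actions" if "E \<in> \<E>" for E using that by (meson order_trans)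
  then have L: "L \<subseteq> mixed_actions" unfolding L_def by (rule UN_least)
  have optimal: "\<exists>x\<in>L. x \<in> maximizers (Phi u H y)"
    and hull: "maximizers (Phi u H y) \<subseteq> convex hull L"
    if y: "y \<in> mixed_actions" for y
  proof -
    define E where "E = maximizers (Phi u H y)"
    have E: "E \<in> \<E>" unfolding \<E>_def E_def using y by (rule imageI)
    have "E \<noteq> {}" using maximizers_nonempty[OF y] by (simp add: E_def)
    then have "V E \<noteq> {}" using V[OF E] convex_hull_eq_empty by blast
    then show "\<exists>x\<in>L. x \<in> maximizers (Phi u H y)"
      using VE[OF E] E unfolding L_def E_def[symmetric] by blast
    have "convex hull V E \<subseteq> convex hull L" using E unfolding L_def by (intro hull_mono UN_upper)
    then show "maximizers (Phi u H y) \<subseteq> convex hull L"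
      using V[OF E] unfolding E_def[symmetric] by blast
  qed
  show ?thesis
    by (intro exI[of _ L] conjI ballI \<open>finite L\<close> L optimal hull
        finite_union_of_polytope_maximizer_region)
qed

theorem lemma4:
  fixes u v :: "'a::finite \<Rightarrow> 'b::finite \<Rightarrow> real"
    and HH :: "'h::{real_vector, topological_space} set"
    and MM :: "'m::{real_vector, topological_space} set"
    and H :: "'a \<Rightarrow> 'b \<Rightarrow> 'h"
    and M :: "'a \<Rightarrow> 'b \<Rightarrow> 'm"
  assumes "convex HH" and "compact HH" and "\<And>a b. H a b \<in> HH"
    and "convex MM" and "compact MM" and "\<And>a b. M a b \<in> MM"
  shows "(\<exists>L. finite L \<and> L \<subseteq> mixed_actions
            \<and> (\<forall>y\<in>mixed_actions. \<exists>x\<in>L. x \<in> maximizers (Phi u H y))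
            \<and> (\<forall>y\<in>mixed_actions. maximizers (Phi u H y) \<subseteq> convex hull L)
            \<and> (\<forall>x\<in>L. (finite union_of polytope)
                  {y \<in> mixed_actions. x \<in> maximizers (Phi u H y)}))
       \<and> (\<exists>K. finite K \<and> K \<subseteq> mixed_actions
            \<and> (\<forall>x\<in>mixed_actions. \<exists>y\<in>K. y \<in> maximizers (Psi v M x))
            \<and> (\<forall>x\<in>mixed_actions. maximizers (Psi v M x) \<subseteq> convex hull K)
            \<and> (\<forall>y\<in>K. (finite union_of polytope)
                  {x \<in> mixed_actions. y \<in> maximizers (Psi v M x)}))"
  \<comment> \<open>Player 2's half is player 1's half for the transposed payoffs \<open>v\<close>
    and signals \<open>M\<close>.\<close>
  unfolding Psi_eq_Phi by (intro conjI finite_optimal_set)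

end
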